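(* For any integer $\ell\ge 1$, $$\ell+1\le\varphi(\ell)\le\left\lfloor\frac{\sqrt{12\ell(\ell+1)+1}-1}{2}\right\rfloor .$$
   Context: $\mathbb{S}^n$ is the space of real symmetric $n\times n$ matrices and $\mathbb{S}^n_+$ its positive semidefinite cone; $Y_{a:b,c:d}$ is the submatrix of $Y$ with rows $a,\dots,b$ and columns $c,\dots,d$. The function $\varphi:\mathbb{N}\to\mathbb{N}$ is defined by $\varphi(0)=0$ and, for $\ell\ge1$, $\varphi(\ell)$ is the smallest integer such that for any $U\in\mathbb{R}^{2\ell\times\ell}$ and $M\in\mathbb{S}^\ell$ the set $$\{Y\in\mathbb{S}^{2\ell}_+:\ U^\top YU=M,\ Y_{1:\ell,1:\ell}=I_\ell,\ Y_{\ell+1:2\ell,\ell+1:2\ell}=I_\ell\}$$ is either empty or contains an element of rank at most $\varphi(\ell)$. *)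

theory Defs
  imports Complex_Main "Jordan_Normal_Form.DL_Rank" "Jordan_Normal_Form.DL_Submatrix"
begin

definition sym_mats :: "nat \<Rightarrow> real mat set" where
  "sym_mats n = {A \<in> carrier_mat n n. A\<^sup>T = A}"

definition psd_mats :: "nat \<Rightarrow> real mat set" where
  "psd_mats n = {A \<in> sym_mats n. \<forall>x \<in> carrier_vec n. 0 \<le> x \<bullet> (A *\<^sub>v x)}"

text \<open>Matrix indices start at 0, so the blocks with rows and columns \<open>1:l\<close> and \<open>l+1:2l\<close>
  are selected by \<open>{0..<l}\<close> and \<open>{l..<2*l}\<close>.\<close>

definition feasible_set :: "nat \<Rightarrow> real mat \<Rightarrow> real mat \<Rightarrow> real mat set" where
  "feasible_set l U M = {Y \<in> psd_mats (2 * l).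
      U\<^sup>T * Y * U = M \<and>
      submatrix Y {0..<l} {0..<l} = 1\<^sub>m l \<and>
      submatrix Y {l..<2 * l} {l..<2 * l} = 1\<^sub>m l}"

definition rank_bound :: "nat \<Rightarrow> nat \<Rightarrow> bool" where
  "rank_bound l r \<longleftrightarrow>
     (\<forall>U \<in> carrier_mat (2 * l) l. \<forall>M \<in> sym_mats l.
        feasible_set l U M = {} \<or>
        (\<exists>Y \<in> feasible_set l U M. vec_space.rank (2 * l) Y \<le> r))"

definition varphi :: "nat \<Rightarrow> nat" where
  "varphi l = (if l = 0 then 0 else (LEAST r. rank_bound l r))"

text \<open>The minimum in the definition of \<^const>\<open>varphi\<close> is attained.\<close>

lemma rank_bound_trivial: "rank_bound l (2 * l)"
proof -
  have "vec_space.rank (2 * l) Y \<le> 2 * l" if "Y \<in> feasible_set l U M" for U M Y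
    using that vec_space.rank_le_nc[of Y "2 * l" "2 * l"]
    by (auto simp: feasible_set_def psd_mats_def sym_mats_def)
  then show ?thesis
    unfolding rank_bound_def by blast
qed

lemma rank_bound_varphi: "l \<ge> 1 \<Longrightarrow> rank_bound l (varphi l)"
  unfolding varphi_def using LeastI[of "rank_bound l" "2 * l"] rank_bound_trivial by simp

lemma varphi_le: "l \<ge> 1 \<Longrightarrow> rank_bound l r \<Longrightarrow> varphi l \<le> r"
  by (simp add: varphi_def Least_le)

end

theory Submission
  imports Defs "Jordan_Normal_Form.DL_Rank_Submatrix" "HOL-Analysis.Function_Topology"
begin

text \<open>The upper bound is the Barvinok--Pataki argument. If \<open>V V\<^sup>T\<close> is feasible, \<open>V\<close> has \<open>r\<close> columns and
  \<open>r (r + 1) / 2\<close> exceeds the number \<open>3 l (l + 1) / 2\<close> of scalar constraints, there is a symmetric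
  \<open>D \<noteq> 0\<close> such that all \<open>V (1 + t D) V\<^sup>T\<close> satisfy the constraints. At a suitable \<open>t\<close> the matrix
  \<open>1 + t D\<close> is singular and positive semidefinite, which saves a column.

  For the lower bound, take both blocks of \<open>U\<close> equal to the identity, so that the constraint
  prescribes the symmetric part of the off-diagonal block \<open>Z\<close> of \<open>Y\<close>; choose it to be
  \<open>diag (1, \<dots>, 1, 0)\<close>. As \<open>Y\<close> is positive semidefinite, \<open>Z\<close> is a contraction, which forces
  \<open>Z = diag (1, \<dots>, 1, 0)\<close>, and then \<open>Y\<close> has rank \<open>l + 1\<close>.\<close>

section \<open>Quadratic forms and positive semidefinite matrices\<close>

lemma bilinear_form_eq_sum:
  fixes A :: "real mat"
  assumes "A \<in> carrier_mat n m" "x \<in> carrier_vec n" "y \<in> carrier_vec m"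
  shows "x \<bullet> (A *\<^sub>v y) = (\<Sum>i<n. \<Sum>j<m. x $ i * A $$ (i, j) * y $ j)"
  using assms
  by (auto simp: scalar_prod_def mult_mat_vec_def sum_distrib_left mult.assoc lessThan_atLeast0
      intro!: sum.cong)

lemma sym_bilinear_comm:
  assumes "A \<in> sym_mats n" "x \<in> carrier_vec n" "y \<in> carrier_vec n"
  shows "x \<bullet> (A *\<^sub>v y) = y \<bullet> (A *\<^sub>v x)"
  using assms transpose_vec_mult_scalar[of A n n y x] comm_scalar_prod[of "A *\<^sub>v x" n y]
  by (auto simp: sym_mats_def)

lemma sym_matsI:
  assumes "A \<in> carrier_mat n n" "\<And>i j. i < n \<Longrightarrow> j < n \<Longrightarrow> A $$ (i, j) = A $$ (j, i)"
  shows "A \<in> sym_mats n"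
  using assms by (auto simp: sym_mats_def)

lemma sym_matsD:
  assumes "A \<in> sym_mats n" "i < n" "j < n"
  shows "A $$ (i, j) = A $$ (j, i)"
  using assms index_transpose_mat(1)[of i A j] by (auto simp: sym_mats_def)

lemma psd_carrier: "A \<in> psd_mats n \<Longrightarrow> A \<in> carrier_mat n n"
  by (simp add: psd_mats_def sym_mats_def)

lemma quadratic_form_add:
  assumes "A \<in> sym_mats n" "x \<in> carrier_vec n" "y \<in> carrier_vec n"
  shows "(x + c \<cdot>\<^sub>v y) \<bullet> (A *\<^sub>v (x + c \<cdot>\<^sub>v y)) =
    x \<bullet> (A *\<^sub>v x) + 2 * c * (x \<bullet> (A *\<^sub>v y)) + c\<^sup>2 * (y \<bullet> (A *\<^sub>v y))"
proof -
  have A: "A \<in> carrier_mat n n"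
    using assms(1) by (simp add: sym_mats_def)
  have "A *\<^sub>v (x + c \<cdot>\<^sub>v y) = A *\<^sub>v x + c \<cdot>\<^sub>v (A *\<^sub>v y)"
    using A assms(2,3) by (simp add: mult_add_distrib_mat_vec mult_mat_vec)
  then show ?thesis
    using A assms sym_bilinear_comm[OF assms(1), of x y]
    by (simp add: add_scalar_prod_distrib[of _ n] scalar_prod_add_distrib[of _ n]
        power2_eq_square algebra_simps)
qed

lemma psd_congruence:
  assumes "A \<in> psd_mats n" "B \<in> carrier_mat n m"
  shows "B\<^sup>T * A * B \<in> psd_mats m"
proof -
  have A: "A \<in> carrier_mat n n" "A\<^sup>T = A" "\<And>x. x \<in> carrier_vec n \<Longrightarrow> 0 \<le> x \<bullet> (A *\<^sub>v x)"
    using assms(1) by (auto simp: psd_mats_def sym_mats_def)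
  have "(B\<^sup>T * A * B)\<^sup>T = B\<^sup>T * (B\<^sup>T * A)\<^sup>T"
    using A assms(2) by (subst transpose_mult[of _ m n _ m]) auto
  also have "(B\<^sup>T * A)\<^sup>T = A * B"
    using A assms(2) by (subst transpose_mult[of _ m n _ n]) auto
  finally have "(B\<^sup>T * A * B)\<^sup>T = B\<^sup>T * A * B"
    using A assms(2) by simp
  moreover have "x \<bullet> (B\<^sup>T * A * B *\<^sub>v x) = (B *\<^sub>v x) \<bullet> (A *\<^sub>v (B *\<^sub>v x))"
    if x: "x \<in> carrier_vec m" for x
  proof -
    have "B\<^sup>T * A * B *\<^sub>v x = B\<^sup>T *\<^sub>v (A *\<^sub>v (B *\<^sub>v x))"
      using A assms(2) x by (simp add: assoc_mult_mat_vec[of _ m n _ m] assoc_mult_mat_vec[of _ m n _ n])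
    then show ?thesis
      using transpose_vec_mult_scalar[OF assms(2) x, of "A *\<^sub>v (B *\<^sub>v x)"] A assms(2) x
        comm_scalar_prod[of "B\<^sup>T *\<^sub>v (A *\<^sub>v (B *\<^sub>v x))" m x]
        comm_scalar_prod[of "A *\<^sub>v (B *\<^sub>v x)" n "B *\<^sub>v x"]
      by simp
  qed
  ultimately show ?thesis
    using A assms(2) by (simp add: psd_mats_def sym_mats_def)
qed

lemma psd_gram:
  assumes "V \<in> carrier_mat n k"
  shows "V * V\<^sup>T \<in> psd_mats n"
proof -
  have "0 \<le> x \<bullet> x" for x :: "real vec"
    by (simp add: scalar_prod_def sum_nonneg)
  then have "1\<^sub>m k \<in> psd_mats k"
    by (auto simp: psd_mats_def sym_mats_def)
  from psd_congruence[OF this, of "V\<^sup>T" n] show ?thesis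
    using assms by simp
qed

text \<open>Along the line \<open>A x + c x\<close> the quadratic term in \<open>c\<close> drops
  out, so the form is affine in \<open>c\<close> with slope \<open>2 |A x|^2\<close>. Being
  nonnegative for all \<open>c\<close>, it must have slope zero.\<close>

lemma psd_null:
  assumes "A \<in> psd_mats n" "x \<in> carrier_vec n" "x \<bullet> (A *\<^sub>v x) = 0"
  shows "A *\<^sub>v x = 0\<^sub>v n"
proof -
  have A: "A \<in> carrier_mat n n" and sym: "A \<in> sym_mats n"
    and nonneg: "\<And>x. x \<in> carrier_vec n \<Longrightarrow> 0 \<le> x \<bullet> (A *\<^sub>v x)"
    using assms(1) by (auto simp: psd_mats_def sym_mats_def)
  define y where "y = A *\<^sub>v x"
  have y: "y \<in> carrier_vec n"
    using A assms(2) by (simp add: y_def)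
  have lin: "0 \<le> y \<bullet> (A *\<^sub>v y) + 2 * c * (y \<bullet> y)" for c
    using nonneg[of "y + c \<cdot>\<^sub>v x"] quadratic_form_add[OF sym y assms(2), of c] y assms(2,3)
    by (simp add: y_def)
  have "y \<bullet> y = 0"
  proof (rule ccontr)
    assume "y \<bullet> y \<noteq> 0"
    \<comment> \<open>This \<open>c\<close> is chosen so that the affine function takes the value
      -1.\<close>
    then show False
      using lin[of "- (y \<bullet> (A *\<^sub>v y) + 1) / (2 * (y \<bullet> y))"] by (simp add: field_simps)
  qed
  then show ?thesis
    using y conjugate_square_eq_0_vec[of y n] unfolding y_def by simp
qed

lemma psd_diag_nonneg:
  assumes "A \<in> psd_mats n" "i < n"
  shows "0 \<le> A $$ (i, i)"
proof -
  have "unit_vec n i \<bullet> (A *\<^sub>v unit_vec n i) = A $$ (i, i)"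
    using psd_carrier[OF assms(1)] assms(2) by simp
  then show ?thesis
    using assms by (metis (no_types, lifting) mem_Collect_eq psd_mats_def unit_vec_carrier)
qed

lemma psd_diag_zero:
  assumes "A \<in> psd_mats n" "i < n" "j < n" "A $$ (i, i) = 0"
  shows "A $$ (j, i) = 0"
proof -
  have A: "A \<in> carrier_mat n n"
    using assms(1) by (rule psd_carrier)
  have "A *\<^sub>v unit_vec n i = 0\<^sub>v n"
    using A assms by (intro psd_null) auto
  then have "(A *\<^sub>v unit_vec n i) $ j = 0"
    using assms by simp
  then show ?thesis
    using A assms by simp
qed

section \<open>Schur complements and Gram factorizations\<close>

text \<open>Completing the square: with \<open>s = x \<bullet> A e_k\<close>, the form of the
  complement at \<open>x\<close> is the form of \<open>A\<close> at
  \<open>x - (s / A_kk) e_k\<close>, hence nonnegative.\<close>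

lemma psd_schur_complement:
  assumes "A \<in> psd_mats n" "k < n" "A $$ (k, k) > 0"
  shows "mat n n (\<lambda>(i, j). A $$ (i, j) - A $$ (i, k) * A $$ (j, k) / A $$ (k, k)) \<in> psd_mats n"
    (is "?S \<in> _")
proof -
  have A: "A \<in> carrier_mat n n" and sym: "A \<in> sym_mats n"
    and nonneg: "\<And>x. x \<in> carrier_vec n \<Longrightarrow> 0 \<le> x \<bullet> (A *\<^sub>v x)"
    using assms(1) by (auto simp: psd_mats_def sym_mats_def)
  let ?d = "A $$ (k, k)"
  have "0 \<le> x \<bullet> (?S *\<^sub>v x)" if x: "x \<in> carrier_vec n" for x
  proof -
    define s where "s = x \<bullet> (A *\<^sub>v unit_vec n k)"
    have s: "s = (\<Sum>i<n. x $ i * A $$ (i, k))"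
    proof -
      have "A *\<^sub>v unit_vec n k = col A k"
        using A assms(2) by (intro eq_vecI) auto
      then show ?thesis
        using A x assms(2) by (simp add: s_def scalar_prod_def lessThan_atLeast0)
    qed
    have "x \<bullet> (?S *\<^sub>v x) = (\<Sum>i<n. \<Sum>j<n. x $ i * A $$ (i, j) * x $ j
        - (x $ i * A $$ (i, k)) * (x $ j * A $$ (j, k)) / ?d)"
      using x by (subst bilinear_form_eq_sum[of _ n n])
        (auto simp: algebra_simps intro!: sum.cong)
    also have "\<dots> = x \<bullet> (A *\<^sub>v x) - s * s / ?d"
      using A x by (simp add: bilinear_form_eq_sum[of _ n n] sum_subtractf s sum_product sum_divide_distrib)
    also have "\<dots> = (x + (- s / ?d) \<cdot>\<^sub>v unit_vec n k) \<bullet> (A *\<^sub>v (x + (- s / ?d) \<cdot>\<^sub>v unit_vec n k))"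
      using A assms(2,3) x
      by (subst quadratic_form_add[OF sym x]) (simp_all add: s_def[symmetric] power2_eq_square field_simps)
    also have "\<dots> \<ge> 0"
      using x by (intro nonneg) simp
    finally show ?thesis .
  qed
  moreover have "?S \<in> sym_mats n"
    using sym_matsD[OF sym] by (intro sym_matsI) auto
  ultimately show ?thesis
    by (simp add: psd_mats_def)
qed

text \<open>Cholesky elimination by outer products. Subtracting the rank-one part at a pivot
  \<open>k\<close> clears diagonal entry \<open>k\<close>, and a zero diagonal entry stays zero
  because its whole column vanishes. Measuring progress by the number of nonzero diagonal entries
  bounds the number of columns of \<open>V\<close> more sharply than \<open>n\<close> does.\<close>

lemma psd_factorization:
  assumes "A \<in> psd_mats n" "card {i. i < n \<and> A $$ (i, i) \<noteq> 0} \<le> m"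
  shows "\<exists>V \<in> carrier_mat n m. A = V * V\<^sup>T"
  using assms
proof (induction m arbitrary: A)
  case 0
  then have "A $$ (i, i) = 0" if "i < n" for i
    using that by simp
  then have "A = 0\<^sub>m n n"
    using psd_diag_zero[OF 0(1)] psd_carrier[OF 0(1)] by auto
  also have "\<dots> = 0\<^sub>m n 0 * (0\<^sub>m n 0)\<^sup>T"
    by (rule eq_matI) (auto simp: scalar_prod_def)
  finally show ?case
    by (rule bexI) simp
next
  case (Suc m)
  have A: "A \<in> carrier_mat n n" and sym: "A \<in> sym_mats n"
    using Suc.prems(1) by (auto simp: psd_mats_def sym_mats_def)
  let ?I = "\<lambda>A. {i. i < n \<and> A $$ (i, i) \<noteq> 0}"
  show ?case
  proof (cases "?I A = {}")
    case True
    then have "card (?I A) \<le> m"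
      by (simp only: card.empty)
    then obtain V where V: "V \<in> carrier_mat n m" "A = V * V\<^sup>T"
      using Suc.IH[OF Suc.prems(1)] by blast
    \<comment> \<open>No pivot is left, so a zero column pads the factor to the required
      width.\<close>
    define W where "W = mat n (Suc m) (\<lambda>(i, j). if j < m then V $$ (i, j) else 0)"
    have "A = W * W\<^sup>T"
      using V A by (intro eq_matI) (auto simp: W_def scalar_prod_def)
    then show ?thesis
      by (rule bexI) (simp add: W_def)
  next
    case False
    then obtain k where k: "k < n" "A $$ (k, k) \<noteq> 0"
      by auto
    define d where "d = A $$ (k, k)"
    have d: "d > 0"
      using psd_diag_nonneg[OF Suc.prems(1) k(1)] k(2) by (simp add: d_def)
    define S where "S = mat n n (\<lambda>(i, j). A $$ (i, j) - A $$ (i, k) * A $$ (j, k) / d)"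
    have S: "S \<in> psd_mats n"
      using psd_schur_complement[OF Suc.prems(1) k(1)] d by (simp add: S_def d_def)
    have "S $$ (i, i) = 0" if i: "i < n" "A $$ (i, i) = 0" for i
    proof -
      have "A $$ (i, k) = 0"
        using psd_diag_zero[OF Suc.prems(1) i(1) k(1) i(2)] sym_matsD[OF sym i(1) k(1)] by simp
      then show ?thesis
        using i by (simp add: S_def)
    qed
    moreover have "S $$ (k, k) = 0"
      using k d by (simp add: S_def d_def)
    ultimately have "?I S \<subseteq> ?I A - {k}"
      by blast
    then have "card (?I S) \<le> card (?I A - {k})"
      by (intro card_mono) auto
    also have "\<dots> \<le> m"
      using k Suc.prems(2) by (subst card_Diff_singleton) auto
    finally obtain V where V: "V \<in> carrier_mat n m" "S = V * V\<^sup>T"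
      using Suc.IH[OF S] by auto
    \<comment> \<open>The outer product of the new column with itself restores the part subtracted
      in \<open>S\<close>.\<close>
    define W where "W = mat n (Suc m) (\<lambda>(i, j). if j < m then V $$ (i, j) else A $$ (i, k) / sqrt d)"
    have "A $$ (i, j) = (W * W\<^sup>T) $$ (i, j)" if ij: "i < n" "j < n" for i j
    proof -
      have "A $$ (i, j) = (V * V\<^sup>T) $$ (i, j) + A $$ (i, k) * A $$ (j, k) / d"
        using ij V(2)[symmetric] by (simp add: S_def)
      then show ?thesis
        using ij V(1) d by (simp add: W_def scalar_prod_def)
    qed
    then have "A = W * W\<^sup>T"
      using A by (intro eq_matI) (auto simp: W_def)
    then show ?thesis
      by (rule bexI) (simp add: W_def)
  qed
qed

section \<open>Rank of a product and underdetermined linear systems\<close>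

text \<open>The product is a sum of \<open>k\<close> outer products, each of rank at most one;
  \<open>G l\<close> is the partial sum of the first \<open>l\<close> of them.\<close>

lemma (in vec_space) rank_mult_le_inner_dim:
  assumes "A \<in> carrier_mat n k" "B \<in> carrier_mat k m"
  shows "rank (A * B) \<le> k"
proof -
  define G where "G l = mat n m (\<lambda>(i, j). \<Sum>c<l. A $$ (i, c) * B $$ (c, j))" for l
  have "rank (G l) \<le> l" for l
  proof (induction l)
    case 0
    have "G 0 = 0\<^sub>m n m"
      by (rule eq_matI) (auto simp: G_def)
    then show ?case
      by (simp add: rank_0I)
  next
    case (Suc l)
    define R where "R = mat n m (\<lambda>(i, j). A $$ (i, l) * B $$ (l, j))"
    have "G (Suc l) = G l + R"
      by (rule eq_matI) (auto simp: G_def R_def)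
    moreover have "rank (G l + R) \<le> rank (G l) + rank R"
      by (rule rank_subadditive[of _ m]) (auto simp: G_def R_def)
    moreover have "rank R \<le> 1"
      by (rule rank_le_1_product_entries[of _ m "\<lambda>i. A $$ (i, l)" "\<lambda>j. B $$ (l, j)"])
        (auto simp: R_def)
    ultimately show ?case
      using Suc.IH by simp
  qed
  moreover have "A * B = G k"
    using assms by (intro eq_matI) (auto simp: G_def scalar_prod_def lessThan_atLeast0)
  ultimately show ?thesis
    by simp
qed

text \<open>Gaussian elimination by induction on the equations. Arbitrary index sets allow the
  unknowns to be matrix positions and the equations to be pairs of vectors later on.\<close>

lemma homogeneous_system_nontrivial:
  fixes a :: "'j \<Rightarrow> 'i \<Rightarrow> 'f :: field"
  assumes "finite J" "card J < card I"
  shows "\<exists>x. (\<exists>i\<in>I. x i \<noteq> 0) \<and> (\<forall>j\<in>J. (\<Sum>i\<in>I. a j i * x i) = 0)"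
  using assms
proof (induction J arbitrary: I a rule: finite_induct)
  case empty
  then have "I \<noteq> {}"
    by auto
  then show ?case
    by (intro exI[of _ "\<lambda>_. 1"]) auto
next
  case (insert j J)
  have I: "finite I"
    using insert.prems by (metis card.infinite not_less_zero)
  show ?case
  proof (cases "\<forall>i\<in>I. a j i = 0")
    case True
    have "card J < card I"
      using insert by simp
    from insert.IH[OF this, of a] True show ?thesis
      by auto
  next
    case False
    then obtain p where p: "p \<in> I" "a j p \<noteq> 0"
      by auto
    \<comment> \<open>Equation \<open>j\<close> is used to eliminate the unknown \<open>p\<close>
      from equation \<open>k\<close>; afterwards \<open>y p\<close> is chosen so that equation
      \<open>j\<close> holds.\<close>
    define b where "b k i = a k i - a k p * a j i / a j p" for k i
    have "card J < card (I - {p})"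
      using insert p I by simp
    from insert.IH[OF this, of b] obtain x where
      x: "\<exists>i\<in>I - {p}. x i \<noteq> 0" "\<And>k. k \<in> J \<Longrightarrow> (\<Sum>i\<in>I - {p}. b k i * x i) = 0"
      by blast
    define s where "s = (\<Sum>i\<in>I - {p}. a j i * x i)"
    define y where "y = x(p := - s / a j p)"
    have split: "(\<Sum>i\<in>I. a k i * y i) = (\<Sum>i\<in>I - {p}. a k i * x i) - a k p * s / a j p" for k
    proof -
      have "(\<Sum>i\<in>I. a k i * y i) = a k p * y p + (\<Sum>i\<in>I - {p}. a k i * y i)"
        using I p by (intro sum.remove) auto
      also have "(\<Sum>i\<in>I - {p}. a k i * y i) = (\<Sum>i\<in>I - {p}. a k i * x i)"
        by (intro sum.cong) (auto simp: y_def)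
      finally show ?thesis
        by (simp add: y_def)
    qed
    have "(\<Sum>i\<in>I. a k i * y i) = 0" if "k \<in> J" for k
    proof -
      have "(\<Sum>i\<in>I - {p}. b k i * x i) = (\<Sum>i\<in>I - {p}. a k i * x i) - a k p * s / a j p"
        by (simp add: b_def s_def algebra_simps sum_subtractf sum_distrib_left sum_divide_distrib)
      then show ?thesis
        using x(2)[OF that] split[of k] by simp
    qed
    moreover have "(\<Sum>i\<in>I. a j i * y i) = 0"
      using p split[of j] by (simp add: s_def)
    moreover have "\<exists>i\<in>I. y i \<noteq> 0"
      using x(1) by (auto simp: y_def)
    ultimately show ?thesis
      by (intro exI[of _ y]) auto
  qed
qed

section \<open>Reaching the boundary of the positive semidefinite cone\<close>

text \<open>A null vector makes one coordinate redundant, so the Gram factor needs one column fewer.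
  This is the saving exploited in \<open>barvinok_pataki\<close>.\<close>

lemma psd_singular_factorization:
  assumes P: "P \<in> psd_mats (Suc s)" and x: "x \<in> carrier_vec (Suc s)" "x \<noteq> 0\<^sub>v (Suc s)"
    and null: "x \<bullet> (P *\<^sub>v x) = 0"
  shows "\<exists>W \<in> carrier_mat (Suc s) s. P = W * W\<^sup>T"
proof -
  let ?r = "Suc s"
  have Pc: "P \<in> carrier_mat ?r ?r" and Pt: "P\<^sup>T = P"
    using P by (auto simp: psd_mats_def sym_mats_def)
  obtain k where k: "k < ?r" "x $ k \<noteq> 0"
    using x by (metis carrier_vecD eq_vecI index_zero_vec(1,2))
  txt \<open>\<open>Q\<close> subtracts the multiple of \<open>x\<close> that clears coordinate \<open>k\<close>. Since \<open>P x = 0\<close>, the form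
    \<open>P\<close> is the pullback along \<open>Q\<close> of its restriction \<open>F\<close> to the vectors with zero coordinate \<open>k\<close>.\<close>
  define E where "E = mat ?r ?r (\<lambda>(i, j). if i = j \<and> i \<noteq> k then 1 else 0 :: real)"
  define Q where "Q = mat ?r ?r (\<lambda>(i, j). (if i = j then 1 else 0) - (if j = k then x $ i / x $ k else 0))"
  have E: "E \<in> carrier_mat ?r ?r" and Q: "Q \<in> carrier_mat ?r ?r"
    by (simp_all add: E_def Q_def)
  have colQ: "col Q j = (if j = k then unit_vec ?r k + (- 1 / x $ k) \<cdot>\<^sub>v x else unit_vec ?r j)"
    if "j < ?r" for j
    using that x k by (intro eq_vecI) (auto simp: Q_def)
  \<comment> \<open>Row \<open>k\<close> of \<open>Q\<close> is zero, so \<open>Q\<close> maps into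
    the vectors that \<open>E\<close> fixes.\<close>
  have EQ: "E * Q = Q"
  proof (rule eq_matI)
    fix i j assume "i < dim_row Q" "j < dim_col Q"
    then have ij: "i < ?r" "j < ?r"
      using Q by auto
    have "row E i = (if i = k then 0\<^sub>v ?r else unit_vec ?r i)"
      using ij by (intro eq_vecI) (auto simp: E_def)
    then show "(E * Q) $$ (i, j) = Q $$ (i, j)"
      using ij E Q k by (auto simp: Q_def)
  qed (use E Q in auto)
  have Pe: "P *\<^sub>v unit_vec ?r j = col P j" if "j < ?r" for j
    using Pc that by (intro eq_vecI) auto
  have "P *\<^sub>v (unit_vec ?r k + c \<cdot>\<^sub>v x) = col P k" for c
    using Pc x k psd_null[OF P x(1) null] Pe[OF k(1)]
    by (auto simp: mult_add_distrib_mat_vec[of _ ?r ?r] mult_mat_vec[of _ ?r ?r])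
  then have "P *\<^sub>v col Q j = col P j" if "j < ?r" for j
    using Pe that by (simp add: colQ)
  then have "col (P * Q) j = col P j" if "j < ?r" for j
    using that by (simp only: col_mult2[OF Pc Q])
  then have PQ: "P * Q = P"
    using Pc Q by (intro mat_col_eqI) (simp_all only: carrier_matD index_mult_mat)
  define F where "F = E\<^sup>T * P * E"
  have Fc: "F \<in> carrier_mat ?r ?r"
    using E Pc by (simp add: F_def)
  have "F \<in> psd_mats ?r"
    unfolding F_def by (rule psd_congruence[OF P E])
  \<comment> \<open>Since \<open>E\<close> kills \<open>e_k\<close>, diagonal entry \<open>k\<close>
    of \<open>F\<close> is zero and at most \<open>s\<close> pivots remain.\<close>
  moreover have "{i. i < ?r \<and> F $$ (i, i) \<noteq> 0} \<subseteq> {..<?r} - {k}"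
  proof -
    have "col E k = 0\<^sub>v ?r"
      using k by (intro eq_vecI) (auto simp: E_def)
    then have "F $$ (k, k) = 0"
      using E Pc k by (simp add: F_def)
    then show ?thesis
      by auto
  qed
  then have "card {i. i < ?r \<and> F $$ (i, i) \<noteq> 0} \<le> card ({..<?r} - {k})"
    by (intro card_mono) auto
  then have "card {i. i < ?r \<and> F $$ (i, i) \<noteq> 0} \<le> s"
    using k by simp
  ultimately obtain W where W: "W \<in> carrier_mat ?r s" "F = W * W\<^sup>T"
    using psd_factorization by blast
  have "P = Q\<^sup>T * P"
    using PQ Pt transpose_mult[OF Pc Q] by simp
  then have "P = Q\<^sup>T * (P * Q)"
    using PQ by simp
  also have "\<dots> = (E * Q)\<^sup>T * (P * (E * Q))"
    by (simp only: EQ)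
  also have "\<dots> = Q\<^sup>T * (F * Q)"
    using E Q Pc by (simp add: F_def transpose_mult[OF E Q] assoc_mult_mat[of _ ?r ?r _ ?r _ ?r])
  also have "\<dots> = (Q\<^sup>T * W) * (Q\<^sup>T * W)\<^sup>T"
    using Q W by (simp add: transpose_mult[of _ ?r ?r _ s] assoc_mult_mat[of _ ?r ?r _ s _ ?r])
  finally show ?thesis
    using Q W(1) by (intro bexI[of _ "Q\<^sup>T * W"]) auto
qed

text \<open>The unit sphere of dimension \<open>r\<close> is modelled by functions on the naturals
  that vanish from \<open>r\<close> on. It is a closed subset of a product of compact sets
  \<open>{-1..1}\<close> and \<open>{0}\<close>, hence compact by Tychonoff.\<close>

lemma compact_unit_sphere_nat_fun:
  "compact {f :: nat \<Rightarrow> real. (\<Sum>i<r. (f i)\<^sup>2) = 1 \<and> (\<forall>i\<ge>r. f i = 0)}"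
proof -
  define K :: "(nat \<Rightarrow> real) set" where "K = PiE UNIV (\<lambda>i. if i < r then {-1..1} else {0})"
  have "compactin (product_topology (\<lambda>_. euclidean) UNIV) K"
    unfolding K_def compactin_PiE by auto
  then have "compact K"
    by (simp add: euclidean_product_topology)
  moreover have "closed {f :: nat \<Rightarrow> real. (\<Sum>i<r. (f i)\<^sup>2) = 1}"
    by (intro closed_Collect_eq continuous_intros continuous_on_product_coordinates)
  ultimately have "compact (K \<inter> {f. (\<Sum>i<r. (f i)\<^sup>2) = 1})"
    by (rule compact_Int_closed)
  moreover have "{f. (\<Sum>i<r. (f i)\<^sup>2) = 1 \<and> (\<forall>i\<ge>r. f i = 0)} = K \<inter> {f. (\<Sum>i<r. (f i)\<^sup>2) = 1}"
  proof -
    have "\<bar>f i\<bar> \<le> 1" if "(\<Sum>i<r. (f i)\<^sup>2) = 1" "i < r" for f :: "nat \<Rightarrow> real" and i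
      using that member_le_sum[of i "{..<r}" "\<lambda>i. (f i)\<^sup>2"] abs_square_le_1 by auto
    moreover have "f \<in> K \<longleftrightarrow> (\<forall>i. if i < r then \<bar>f i\<bar> \<le> 1 else f i = 0)" for f
    proof -
      have "f \<in> K \<longleftrightarrow> (\<forall>i. f i \<in> (if i < r then {-1..1} else {0}))"
        by (simp add: K_def PiE_iff)
      also have "\<dots> \<longleftrightarrow> (\<forall>i. if i < r then \<bar>f i\<bar> \<le> 1 else f i = 0)"
        by (intro iff_allI) (auto simp: abs_le_iff)
      finally show ?thesis .
    qed
    ultimately show ?thesis
      by (auto simp: linorder_not_less split: if_splits)
  qed
  ultimately show ?thesis
    by simp
qed

text \<open>Polarization: if the form vanished everywhere, its value at \<open>e_i + e_j\<close>
  would give \<open>2 * D_ij = 0\<close>.\<close>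

lemma sym_quadratic_form_nonzero:
  assumes "D \<in> sym_mats r" "D \<noteq> 0\<^sub>m r r"
  obtains y where "y \<in> carrier_vec r" "y \<bullet> (D *\<^sub>v y) \<noteq> 0"
proof -
  have Dc: "D \<in> carrier_mat r r"
    using assms by (simp add: sym_mats_def)
  have entry: "unit_vec r i \<bullet> (D *\<^sub>v unit_vec r j) = D $$ (i, j)" if "i < r" "j < r" for i j
    using Dc that by simp
  have "\<exists>y \<in> carrier_vec r. y \<bullet> (D *\<^sub>v y) \<noteq> 0"
  proof (rule ccontr)
    assume "\<not> ?thesis"
    then have z: "\<And>y. y \<in> carrier_vec r \<Longrightarrow> y \<bullet> (D *\<^sub>v y) = 0"
      by auto
    have "D $$ (i, j) = 0" if ij: "i < r" "j < r" for i j
      using quadratic_form_add[OF assms(1), of "unit_vec r i" "unit_vec r j" 1]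
        z[of "unit_vec r i + 1 \<cdot>\<^sub>v unit_vec r j"] z[of "unit_vec r i"] z[of "unit_vec r j"]
        entry[OF ij] by (simp del: one_smult_vec)
    then have "D = 0\<^sub>m r r"
      using Dc by (intro eq_matI) auto
    with assms(2) show False ..
  qed
  then show thesis
    using that by blast
qed

text \<open>The parameter is \<open>t = - 1 / \<lambda>\<close> for an eigenvalue \<lambda> of
  \<open>D\<close> of largest modulus, obtained as an extreme value of the form on the unit sphere.
  Maximizing the absolute value treats both signs of \<lambda> at once.\<close>

lemma psd_boundary_of_pencil:
  assumes "D \<in> sym_mats r" "D \<noteq> 0\<^sub>m r r"
  obtains t x where "1\<^sub>m r + t \<cdot>\<^sub>m D \<in> psd_mats r" "x \<in> carrier_vec r" "x \<noteq> 0\<^sub>v r"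
    "x \<bullet> ((1\<^sub>m r + t \<cdot>\<^sub>m D) *\<^sub>v x) = 0"
proof -
  have Dc: "D \<in> carrier_mat r r"
    using assms by (simp add: sym_mats_def)
  define S where "S = {f :: nat \<Rightarrow> real. (\<Sum>i<r. (f i)\<^sup>2) = 1 \<and> (\<forall>i\<ge>r. f i = 0)}"
  define q where "q f = (\<Sum>i<r. \<Sum>j<r. f i * D $$ (i, j) * f j)" for f
  have q: "x \<bullet> (D *\<^sub>v x) = q (($) x)" if "x \<in> carrier_vec r" for x
    using bilinear_form_eq_sum[OF Dc that that] by (simp add: q_def)
  have sq: "x \<bullet> x = (\<Sum>i<r. (x $ i)\<^sup>2)" if "x \<in> carrier_vec r" for x :: "real vec"
    using that by (simp add: scalar_prod_def power2_eq_square lessThan_atLeast0)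
  have pos: "x \<bullet> x > 0" if "x \<in> carrier_vec r" "x \<noteq> 0\<^sub>v r" for x :: "real vec"
  proof -
    have "x \<bullet> x \<ge> 0"
      using that by (simp add: sq sum_nonneg)
    then show ?thesis
      using that conjugate_square_eq_0_vec[of x r] by (simp add: less_le)
  qed
  \<comment> \<open>Normalizing \<open>y\<close> shows that its Rayleigh quotient is a value of
    \<open>q\<close> on the sphere.\<close>
  have scaled: "\<exists>f\<in>S. q f = y \<bullet> (D *\<^sub>v y) / (y \<bullet> y)" if y: "y \<in> carrier_vec r" "y \<noteq> 0\<^sub>v r" for y
  proof -
    define d where "d = sqrt (y \<bullet> y)"
    have d: "d > 0" "d * d = y \<bullet> y"
      using pos[OF y] by (simp_all add: d_def)
    define f where "f i = (if i < r then y $ i / d else 0)" for i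
    have "(\<Sum>i<r. (f i)\<^sup>2) = (\<Sum>i<r. (y $ i)\<^sup>2 / (y \<bullet> y))"
      using d by (intro sum.cong) (auto simp: f_def power2_eq_square)
    also have "\<dots> = 1"
      using pos[OF y] sq[OF y(1)] by (simp add: sum_divide_distrib[symmetric])
    finally have "f \<in> S"
      by (simp add: S_def f_def)
    moreover have "q f = y \<bullet> (D *\<^sub>v y) / (y \<bullet> y)"
      unfolding q[OF y(1)] q_def sum_divide_distrib d(2)[symmetric]
      by (intro sum.cong) (auto simp: f_def)
    ultimately show ?thesis
      by blast
  qed
  obtain y where y: "y \<in> carrier_vec r" "y \<bullet> (D *\<^sub>v y) \<noteq> 0"
    using sym_quadratic_form_nonzero[OF assms] .
  then have y0: "y \<noteq> 0\<^sub>v r"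
    using Dc by auto
  have "continuous_on S (\<lambda>f. \<bar>q f\<bar>)"
    unfolding q_def by (intro continuous_intros continuous_on_subset[OF continuous_on_product_coordinates]) auto
  moreover have "S \<noteq> {}"
    using scaled[OF y(1) y0] by auto
  ultimately obtain f where f: "f \<in> S" "\<And>g. g \<in> S \<Longrightarrow> \<bar>q g\<bar> \<le> \<bar>q f\<bar>"
    using continuous_attains_sup[of S "\<lambda>f. \<bar>q f\<bar>"] compact_unit_sphere_nat_fun[of r]
    unfolding S_def by blast
  have bound: "\<bar>z \<bullet> (D *\<^sub>v z)\<bar> \<le> \<bar>q f\<bar> * (z \<bullet> z)" if z: "z \<in> carrier_vec r" for z
  proof (cases "z = 0\<^sub>v r")
    case True
    then show ?thesis
      using Dc by simp
  next
    case False
    then obtain g where g: "g \<in> S" "q g = z \<bullet> (D *\<^sub>v z) / (z \<bullet> z)"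
      using scaled[OF z] by blast
    then show ?thesis
      using f(2)[OF g(1)] pos[OF z False] by (simp add: abs_divide divide_le_eq)
  qed
  have qf: "q f \<noteq> 0"
    using bound[OF y(1)] y(2) by auto
  txt \<open>\<open>f\<close> maximizes \<open>\<bar>q\<bar>\<close> on the unit sphere, so the form of \<open>1 - D / q f\<close> is nonnegative and
    vanishes at \<open>f\<close>.\<close>
  define P where "P = 1\<^sub>m r + (- 1 / q f) \<cdot>\<^sub>m D"
  have P: "z \<bullet> (P *\<^sub>v z) = z \<bullet> z - z \<bullet> (D *\<^sub>v z) / q f" if z: "z \<in> carrier_vec r" for z
  proof -
    have "P *\<^sub>v z = z + (- 1 / q f) \<cdot>\<^sub>v (D *\<^sub>v z)"
      using Dc z unfolding P_def
      by (subst add_mult_distrib_mat_vec[of _ r r]) (auto intro!: eq_vecI)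
    then show ?thesis
      using Dc z by (simp add: scalar_prod_add_distrib[of _ r])
  qed
  have "0 \<le> z \<bullet> (P *\<^sub>v z)" if z: "z \<in> carrier_vec r" for z
  proof -
    have "\<bar>z \<bullet> (D *\<^sub>v z) / q f\<bar> \<le> z \<bullet> z"
      using bound[OF z] qf by (simp add: abs_divide divide_le_eq mult.commute)
    then show ?thesis
      unfolding P[OF z] by linarith
  qed
  moreover have "P \<in> sym_mats r"
    using sym_matsD[OF assms(1)] Dc by (intro sym_matsI) (auto simp: P_def)
  ultimately have "P \<in> psd_mats r"
    by (simp add: psd_mats_def)
  moreover have "vec r f \<bullet> vec r f = 1" "vec r f \<bullet> (D *\<^sub>v vec r f) = q f"
    using f(1) by (auto simp: sq q S_def q_def)
  moreover from this have "vec r f \<noteq> 0\<^sub>v r" "vec r f \<bullet> (P *\<^sub>v vec r f) = 0"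
    using qf by (auto simp: P)
  ultimately show thesis
    using that[of "- 1 / q f" "vec r f"] by (simp add: P_def)
qed

section \<open>The Barvinok-Pataki rank bound\<close>

text \<open>The triangle indexes the free entries of a symmetric matrix. The count serves for the
  unknowns in \<open>barvinok_pataki\<close> and for the constraints in
  \<open>feasible_low_rank\<close>.\<close>

lemma card_triangle: "2 * card (SIGMA i:{..<r}. {..i}) = r * (r + 1)"
  by (induction r) (auto simp: algebra_simps)

text \<open>A constraint is encoded as a pair of vectors at which the bilinear form is prescribed;
  this covers entries of \<open>Y\<close> and entries of \<open>U\<^sup>T * Y * U\<close>
  alike.\<close>

theorem barvinok_pataki:
  assumes Y: "Y \<in> psd_mats n" and C: "finite C" "C \<subseteq> carrier_vec n \<times> carrier_vec n"
  obtains Z where "Z \<in> psd_mats n"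
    "\<And>u w. (u, w) \<in> C \<Longrightarrow> u \<bullet> (Z *\<^sub>v w) = u \<bullet> (Y *\<^sub>v w)"
    "vec_space.rank n Z * (vec_space.rank n Z + 1) \<le> 2 * card C"
proof -
  define feas where "feas r \<longleftrightarrow> (\<exists>V \<in> carrier_mat n r. \<forall>(u, w) \<in> C.
    u \<bullet> (V * V\<^sup>T *\<^sub>v w) = u \<bullet> (Y *\<^sub>v w))" for r
  have "card {i. i < n \<and> Y $$ (i, i) \<noteq> 0} \<le> card {..<n}"
    by (intro card_mono) auto
  then have "feas n"
    using psd_factorization[OF Y, of n] by (auto simp: feas_def)
  \<comment> \<open>With the number of columns minimal, saving a single column is already a
    contradiction, so the reduction need not be iterated.\<close>
  define r where "r = (LEAST r. feas r)"
  have "feas r"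
    using \<open>feas n\<close> unfolding r_def by (rule LeastI)
  then obtain V where V: "V \<in> carrier_mat n r"
    and VC: "\<And>u w. (u, w) \<in> C \<Longrightarrow> u \<bullet> (V * V\<^sup>T *\<^sub>v w) = u \<bullet> (Y *\<^sub>v w)"
    by (auto simp: feas_def)
  have pull: "u \<bullet> (V * A * V\<^sup>T *\<^sub>v w) = (V\<^sup>T *\<^sub>v u) \<bullet> (A *\<^sub>v (V\<^sup>T *\<^sub>v w))"
    if "u \<in> carrier_vec n" "w \<in> carrier_vec n" "A \<in> carrier_mat r r" for u w A
    using that V transpose_vec_mult_scalar[of V n r "A *\<^sub>v (V\<^sup>T *\<^sub>v w)" u]
    by (simp add: assoc_mult_mat_vec[of _ n r _ n] assoc_mult_mat_vec[of _ n r _ r])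
  have "r * (r + 1) \<le> 2 * card C"
  proof (rule ccontr)
    assume less: "\<not> ?thesis"
    define T where "T = (SIGMA i:{..<r}. {..i})"
    txt \<open>\<open>T\<close> indexes the free entries of a symmetric \<open>r \<times> r\<close> matrix, and \<open>h\<close> sends a position to
      its representative in \<open>T\<close>.\<close>
    define h where "h p = (max (fst p) (snd p), min (fst p) (snd p))" for p :: "nat \<times> nat"
    let ?R = "{..<r} \<times> {..<r}"
    \<comment> \<open>\<open>a c t\<close> is the coefficient of the free entry \<open>t\<close> of
      \<open>D\<close> in the value of its form at \<open>V\<^sup>T *\<^sub>v fst c\<close> and
      \<open>V\<^sup>T *\<^sub>v snd c\<close>; an off-diagonal \<open>t\<close> collects two
      mirrored positions.\<close>
    define a where "a c t = (\<Sum>p | p \<in> ?R \<and> h p = t.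
      (V\<^sup>T *\<^sub>v fst c) $ fst p * (V\<^sup>T *\<^sub>v snd c) $ snd p)" for c t
    have "card C < card T"
      using less card_triangle[of r] by (simp add: T_def)
    then obtain x where x: "\<exists>t\<in>T. x t \<noteq> 0" "\<And>c. c \<in> C \<Longrightarrow> (\<Sum>t\<in>T. a c t * x t) = 0"
      using homogeneous_system_nontrivial[OF C(1), of T a] by blast
    define D where "D = mat r r (\<lambda>p. x (h p))"
    have Dc: "D \<in> carrier_mat r r"
      by (simp add: D_def)
    have "D \<in> sym_mats r"
      by (intro sym_matsI) (auto simp: D_def h_def max.commute min.commute)
    moreover have "D \<noteq> 0\<^sub>m r r"
    proof
      assume D0: "D = 0\<^sub>m r r"
      have "x t = 0" if "t \<in> T" for t
      proof -
        obtain i j where t: "t = (i, j)" "j \<le> i" "i < r"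
          using \<open>t \<in> T\<close> by (auto simp: T_def)
        then have "D $$ (i, j) = x (i, j)"
          by (simp add: D_def h_def)
        then show ?thesis
          using t D0 by simp
      qed
      with x(1) show False
        by blast
    qed
    ultimately obtain t y where ty: "1\<^sub>m r + t \<cdot>\<^sub>m D \<in> psd_mats r" "y \<in> carrier_vec r"
      "y \<noteq> 0\<^sub>v r" "y \<bullet> ((1\<^sub>m r + t \<cdot>\<^sub>m D) *\<^sub>v y) = 0"
      by (rule psd_boundary_of_pencil)
    obtain s where s: "r = Suc s"
      using less by (cases r) auto
    obtain W where W: "W \<in> carrier_mat r s" "1\<^sub>m r + t \<cdot>\<^sub>m D = W * W\<^sup>T"
      using psd_singular_factorization[of _ s y] ty unfolding s by blast
    have "u \<bullet> ((V * W) * (V * W)\<^sup>T *\<^sub>v w) = u \<bullet> (Y *\<^sub>v w)" if c: "(u, w) \<in> C" for u w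
    proof -
      have uw: "u \<in> carrier_vec n" "w \<in> carrier_vec n"
        using C(2) c by auto
      define p q where "p = V\<^sup>T *\<^sub>v u" and "q = V\<^sup>T *\<^sub>v w"
      have pq: "p \<in> carrier_vec r" "q \<in> carrier_vec r"
        using V uw by (auto simp: p_def q_def)
      have "p \<bullet> (D *\<^sub>v q) = (\<Sum>(i, j) \<in> ?R. p $ i * D $$ (i, j) * q $ j)"
        using Dc pq by (simp add: bilinear_form_eq_sum[of _ r r] sum.cartesian_product)
      also have "\<dots> = (\<Sum>e \<in> ?R. (p $ fst e * q $ snd e) * x (h e))"
        by (intro sum.cong) (auto simp: D_def)
      also have "\<dots> = (\<Sum>t \<in> T. \<Sum>e | e \<in> ?R \<and> h e = t. (p $ fst e * q $ snd e) * x (h e))"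
        by (intro sum.group[symmetric]) (auto simp: T_def h_def)
      also have "\<dots> = (\<Sum>t \<in> T. a (u, w) t * x t)"
        by (intro sum.cong) (auto simp: a_def p_def q_def sum_distrib_right)
      finally have "p \<bullet> (D *\<^sub>v q) = 0"
        using x(2)[OF c] by simp
      then have "p \<bullet> ((1\<^sub>m r + t \<cdot>\<^sub>m D) *\<^sub>v q) = p \<bullet> q"
      proof -
        have "(1\<^sub>m r + t \<cdot>\<^sub>m D) *\<^sub>v q = q + t \<cdot>\<^sub>v (D *\<^sub>v q)"
          using Dc pq by (subst add_mult_distrib_mat_vec[of _ r r]) (auto intro!: eq_vecI)
        then show ?thesis
          using Dc pq \<open>p \<bullet> (D *\<^sub>v q) = 0\<close> by (simp add: scalar_prod_add_distrib[of _ r])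
      qed
      moreover have "(V * W) * (V * W)\<^sup>T = V * (W * W\<^sup>T) * V\<^sup>T"
        using V W(1) by (simp add: transpose_mult[of _ n r _ s] assoc_mult_mat[of _ n r _ s _ n]
            assoc_mult_mat[of _ n r _ r _ n] assoc_mult_mat[of _ r s _ r _ n])
      moreover have "u \<bullet> (Y *\<^sub>v w) = p \<bullet> q"
        using pull[OF uw, of "1\<^sub>m r"] VC[OF c] V pq by (simp add: p_def q_def)
      ultimately show ?thesis
        using pull[OF uw, of "W * W\<^sup>T"] W by (simp add: p_def q_def)
    qed
    then have "feas s"
      using V W(1) by (auto simp: feas_def intro!: bexI[of _ "V * W"])
    then have "r \<le> s"
      unfolding r_def by (rule Least_le)
    with s show False
      by simp
  qed
  moreover have "vec_space.rank n (V * V\<^sup>T) \<le> r"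
    using V by (intro vec_space.rank_mult_le_inner_dim) auto
  then have "vec_space.rank n (V * V\<^sup>T) * (vec_space.rank n (V * V\<^sup>T) + 1) \<le> r * (r + 1)"
    by (intro mult_le_mono) auto
  ultimately show thesis
    using that[of "V * V\<^sup>T"] psd_gram[OF V] VC by simp
qed

section \<open>The constraints in coordinates\<close>

text \<open>\<open>submatrix\<close> renumbers \<open>J\<close> in increasing order. Counting the
  smaller elements inverts \<open>pick\<close>, so the renumbering is injective and keeps diagonal
  and off-diagonal positions apart.\<close>

lemma submatrix_eq_one_iff:
  fixes A :: "'a :: zero_neq_one mat"
  assumes "A \<in> carrier_mat n n" "J \<subseteq> {..<n}"
  shows "submatrix A J J = 1\<^sub>m (card J) \<longleftrightarrow>
    (\<forall>a\<in>J. \<forall>b\<in>J. A $$ (a, b) = (if a = b then 1 else 0))"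
proof
  have J: "{i. i < n \<and> i \<in> J} = J"
    using assms(2) by auto
  have fin: "finite J"
    using assms(2) finite_subset by blast
  {
    assume eq: "submatrix A J J = 1\<^sub>m (card J)"
    show "\<forall>a\<in>J. \<forall>b\<in>J. A $$ (a, b) = (if a = b then 1 else 0)"
    proof (intro ballI)
      fix a b
      assume ab: "a \<in> J" "b \<in> J"
      let ?k = "\<lambda>a. card {x \<in> J. x < a}"
      have less: "?k a < card J" if "a \<in> J" for a
        using that fin by (intro psubset_card_mono) auto
      have "A $$ (a, b) = 1\<^sub>m (card J) $$ (?k a, ?k b)"
        using submatrix_index_card[of a A b J J] ab assms eq by (auto simp: subset_iff)
      moreover have "?k a = ?k b \<longleftrightarrow> a = b"
        using pick_card_in_set[OF ab(1)] pick_card_in_set[OF ab(2)] by metis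
      ultimately show "A $$ (a, b) = (if a = b then 1 else 0)"
        using less[OF ab(1)] less[OF ab(2)] by simp
    qed
  }
  {
    assume *: "\<forall>a\<in>J. \<forall>b\<in>J. A $$ (a, b) = (if a = b then 1 else 0)"
    show "submatrix A J J = 1\<^sub>m (card J)"
    proof (rule eq_matI)
      fix i j
      assume "i < dim_row (1\<^sub>m (card J) :: 'a mat)" "j < dim_col (1\<^sub>m (card J) :: 'a mat)"
      then have ij: "i < card J" "j < card J"
        by auto
      have "submatrix A J J $$ (i, j) = A $$ (pick J i, pick J j)"
        using ij assms(1) J by (intro submatrix_index) auto
      also have "\<dots> = (if pick J i = pick J j then 1 else 0)"
        using * pick_in_set[of i J] pick_in_set[of j J] ij by blast
      also have "pick J i = pick J j \<longleftrightarrow> i = j"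
        using card_pick[of i J] card_pick[of j J] ij by metis
      finally show "submatrix A J J $$ (i, j) = 1\<^sub>m (card J) $$ (i, j)"
        using ij by simp
    qed (use assms(1) J in \<open>auto simp: dim_submatrix\<close>)
  }
qed

lemma feasible_set_iff:
  assumes "Y \<in> carrier_mat (2 * l) (2 * l)"
  shows "Y \<in> feasible_set l U M \<longleftrightarrow> Y \<in> psd_mats (2 * l) \<and> U\<^sup>T * Y * U = M \<and>
    (\<forall>i<l. \<forall>j<l. Y $$ (i, j) = (if i = j then 1 else 0)) \<and>
    (\<forall>i<l. \<forall>j<l. Y $$ (l + i, l + j) = (if i = j then 1 else 0))"
proof -
  have "submatrix Y {0..<l} {0..<l} = 1\<^sub>m l \<longleftrightarrow>
      (\<forall>i<l. \<forall>j<l. Y $$ (i, j) = (if i = j then 1 else 0))"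
  proof -
    have "{0..<l} \<subseteq> {..<2 * l}"
      by auto
    then show ?thesis
      using submatrix_eq_one_iff[OF assms, of "{0..<l}"] by (auto simp: Ball_def)
  qed
  moreover have "submatrix Y {l..<2 * l} {l..<2 * l} = 1\<^sub>m l \<longleftrightarrow>
      (\<forall>i<l. \<forall>j<l. Y $$ (l + i, l + j) = (if i = j then 1 else 0))"
  proof -
    have "{l..<2 * l} = (+) l ` {..<l}"
      by (simp add: lessThan_atLeast0 image_add_atLeastLessThan mult_2)
    then have "(\<forall>a\<in>{l..<2 * l}. \<forall>b\<in>{l..<2 * l}. Y $$ (a, b) = (if a = b then 1 else 0)) \<longleftrightarrow>
        (\<forall>i<l. \<forall>j<l. Y $$ (l + i, l + j) = (if i = j then 1 else 0))"
      by auto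
    moreover have "{l..<2 * l} \<subseteq> {..<2 * l}" "card {l..<2 * l} = l"
      by auto
    ultimately show ?thesis
      using submatrix_eq_one_iff[OF assms, of "{l..<2 * l}"] by (simp only:)
  qed
  ultimately show ?thesis
    by (simp add: feasible_set_def)
qed

text \<open>This puts the constraint on \<open>U\<^sup>T * Y * U\<close> into the bilinear shape
  required by \<open>barvinok_pataki\<close>.\<close>

lemma congruence_entry:
  assumes "U \<in> carrier_mat n m" "Y \<in> carrier_mat n n" "i < m" "j < m"
  shows "(U\<^sup>T * Y * U) $$ (i, j) = col U i \<bullet> (Y *\<^sub>v col U j)"
proof -
  have "U\<^sup>T * Y * U = U\<^sup>T * (Y * U)"
    using assms by simp
  then show ?thesis
    using assms by (simp add: mult_mat_vec_def col_mult2[of _ n n _ m])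
qed

section \<open>The upper bound\<close>

text \<open>Feasibility amounts to three symmetric \<open>l\<close> by \<open>l\<close> matrix
  equations. Each needs only its lower triangle, which gives at most
  \<open>3 * l * (l + 1) / 2\<close> scalar constraints.\<close>

lemma feasible_low_rank:
  assumes U: "U \<in> carrier_mat (2 * l) l" and Y: "Y \<in> feasible_set l U M"
  obtains Z where "Z \<in> feasible_set l U M"
    "vec_space.rank (2 * l) Z * (vec_space.rank (2 * l) Z + 1) \<le> 3 * l * (l + 1)"
proof -
  let ?n = "2 * l"
  have Yp: "Y \<in> psd_mats ?n"
    using Y by (simp add: feasible_set_def)
  define T where "T = (SIGMA i:{..<l}. {..i})"
  define P where "P f = (\<lambda>(i, j). (f i, f j)) ` T" for f :: "nat \<Rightarrow> real vec"
  define C where "C = P (col U) \<union> (P (unit_vec ?n) \<union> P (\<lambda>i. unit_vec ?n (l + i)))"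
  \<comment> \<open>Only an inequality holds in general, since columns of \<open>U\<close> may
    coincide.\<close>
  have card_P: "finite (P f)" "card (P f) \<le> card T" for f
    unfolding P_def by (auto simp: T_def simp del: card_SigmaI intro!: card_image_le)
  have "card C \<le> card T + (card T + card T)"
    unfolding C_def by (intro order_trans[OF card_Un_le] add_mono card_P)
  then have cardC: "2 * card C \<le> 3 * l * (l + 1)"
    using card_triangle[of l] by (simp add: T_def)
  have "C \<subseteq> carrier_vec ?n \<times> carrier_vec ?n"
    using U by (auto simp: C_def P_def intro!: carrier_vecI)
  moreover have "finite C"
    by (simp add: C_def card_P)
  ultimately obtain Z where Z: "Z \<in> psd_mats ?n"
    "\<And>u w. (u, w) \<in> C \<Longrightarrow> u \<bullet> (Z *\<^sub>v w) = u \<bullet> (Y *\<^sub>v w)"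
    "vec_space.rank ?n Z * (vec_space.rank ?n Z + 1) \<le> 2 * card C"
    using barvinok_pataki[OF Yp] by blast
  have Yc: "Y \<in> carrier_mat ?n ?n" and Zc: "Z \<in> carrier_mat ?n ?n"
    and Ys: "Y \<in> sym_mats ?n" and Zs: "Z \<in> sym_mats ?n"
    using Yp Z(1) by (auto simp: psd_mats_def sym_mats_def)
  \<comment> \<open>The pairs with \<open>j \<le> i\<close> are constrained directly; the others
    follow from the symmetry of \<open>Z\<close> and \<open>Y\<close>.\<close>
  have agree: "f i \<bullet> (Z *\<^sub>v f j) = f i \<bullet> (Y *\<^sub>v f j)"
    if f: "P f \<subseteq> C" "\<And>i. i < l \<Longrightarrow> f i \<in> carrier_vec ?n" and ij: "i < l" "j < l" for f i j
  proof (cases "j \<le> i")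
    case True
    then have "(f i, f j) \<in> P f"
      using ij by (auto simp: P_def T_def)
    then show ?thesis
      using Z(2) f(1) by blast
  next
    case False
    then have "(f j, f i) \<in> P f"
      using ij by (force simp: P_def T_def)
    then have "f j \<bullet> (Z *\<^sub>v f i) = f j \<bullet> (Y *\<^sub>v f i)"
      using Z(2) f(1) by blast
    then show ?thesis
      using sym_bilinear_comm[OF Zs f(2) f(2)] sym_bilinear_comm[OF Ys f(2) f(2)] ij by metis
  qed
  have sub: "P (unit_vec ?n) \<subseteq> C" "P (\<lambda>i. unit_vec ?n (l + i)) \<subseteq> C"
    by (auto simp: C_def)
  have entry: "unit_vec ?n i \<bullet> (A *\<^sub>v unit_vec ?n j) = A $$ (i, j)"
    if "A \<in> carrier_mat ?n ?n" "i < ?n" "j < ?n" for A :: "real mat" and i j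
    using that by simp
  have "U\<^sup>T * Z * U = U\<^sup>T * Y * U"
  proof (rule eq_matI)
    fix i j
    assume "i < dim_row (U\<^sup>T * Y * U)" "j < dim_col (U\<^sup>T * Y * U)"
    then have ij: "i < l" "j < l"
      using U by auto
    show "(U\<^sup>T * Z * U) $$ (i, j) = (U\<^sup>T * Y * U) $$ (i, j)"
      unfolding congruence_entry[OF U Zc ij] congruence_entry[OF U Yc ij]
      using U ij by (intro agree) (auto simp: C_def)
  qed (use U in auto)
  moreover have "Z $$ (i, j) = Y $$ (i, j)" if "i < l" "j < l" for i j
    using that agree[OF sub(1), of i j] entry[OF Zc, of i j] entry[OF Yc, of i j] by simp
  moreover have "Z $$ (l + i, l + j) = Y $$ (l + i, l + j)" if "i < l" "j < l" for i j
    using that agree[OF sub(2), of i j]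
      entry[OF Zc, of "l + i" "l + j"] entry[OF Yc, of "l + i" "l + j"] by simp
  ultimately have "Z \<in> feasible_set l U M"
    using Y Z(1) by (simp add: feasible_set_iff[OF Zc] feasible_set_iff[OF Yc])
  then show thesis
    using that Z(3) cardC by (meson order_trans)
qed

lemma rank_bound_upper:
  assumes "\<And>k. k * (k + 1) \<le> 3 * l * (l + 1) \<Longrightarrow> k \<le> r"
  shows "rank_bound l r"
  unfolding rank_bound_def using feasible_low_rank assms by (metis ex_in_conv)

section \<open>The lower bound\<close>

text \<open>For the instance built here, every feasible \<open>Y\<close> contains an identity matrix
  of size \<open>l + 1\<close> as a principal submatrix.\<close>

lemma rank_bound_lower:
  assumes "rank_bound l r" "l \<ge> 1"
  shows "l + 1 \<le> r"
proof -
  let ?n = "2 * l"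
  \<comment> \<open>Row \<open>i\<close> of \<open>V\<close> is the basis vector numbered
    \<open>c i\<close> in dimension \<open>l + 1\<close>. The second block repeats the vectors of
    the first, except that its last row is the new vector numbered \<open>l\<close>.\<close>
  define c where "c i = (if i < l then i else if i = ?n - 1 then l else i - l)" for i
  define V where "V = mat ?n (Suc l) (\<lambda>(i, j). if j = c i then 1 else 0 :: real)"
  define Y\<^sub>0 where "Y\<^sub>0 = V * V\<^sup>T"
  define U where "U = mat ?n l (\<lambda>(i, j). if i = j \<or> i = l + j then 1 else 0 :: real)"
  have Vc: "V \<in> carrier_mat ?n (Suc l)" and Uc: "U \<in> carrier_mat ?n l"
    by (simp_all add: V_def U_def)
  have Y\<^sub>0: "Y\<^sub>0 \<in> psd_mats ?n"
    unfolding Y\<^sub>0_def by (rule psd_gram[OF Vc])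
  have Y\<^sub>0_entry: "Y\<^sub>0 $$ (i, j) = (if c i = c j then 1 else 0)" if "i < ?n" "j < ?n" for i j
  proof -
    have "Y\<^sub>0 $$ (i, j) = (\<Sum>k\<in>{0..<Suc l}. (if k = c i then 1 else 0) * (if k = c j then 1 else 0))"
      using that by (simp add: Y\<^sub>0_def V_def scalar_prod_def del: sum.op_ivl_Suc)
    also have "\<dots> = (\<Sum>k\<in>{0..<Suc l}. if k = c i then (if c i = c j then 1 else 0) else 0)"
      by (intro sum.cong) auto
    also have "\<dots> = (if c i = c j then 1 else 0)"
    proof -
      have "c i < Suc l"
        using that by (auto simp: c_def)
      then show ?thesis
        by (simp del: sum.op_ivl_Suc)
    qed
    finally show ?thesis .
  qed
  define M where "M = U\<^sup>T * Y\<^sub>0 * U"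
  have "M \<in> sym_mats l"
    using psd_congruence[OF Y\<^sub>0 Uc] by (simp add: M_def psd_mats_def)
  moreover have Y\<^sub>0f: "Y\<^sub>0 \<in> feasible_set l U M"
    using assms(2) Y\<^sub>0 by (auto simp: feasible_set_iff[OF psd_carrier[OF Y\<^sub>0]] M_def Y\<^sub>0_entry c_def)
  ultimately obtain Y where Y: "Y \<in> feasible_set l U M" and rank: "vec_space.rank ?n Y \<le> r"
    using assms(1) Uc unfolding rank_bound_def by blast
  have Yp: "Y \<in> psd_mats ?n" and Ys: "Y \<in> sym_mats ?n"
    using Y by (auto simp: feasible_set_def psd_mats_def)
  note Yc = psd_carrier[OF Yp]
  note Y_iff = Y[unfolded feasible_set_iff[OF Yc]]
  have lower: "Y $$ (l + i, l + j) = (if i = j then 1 else 0)" if "i < l" "j < l" for i j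
    using Y_iff that by blast
  let ?e = "unit_vec ?n :: nat \<Rightarrow> real vec"
  have entry: "?e i \<bullet> (A *\<^sub>v ?e j) = A $$ (i, j)"
    if "A \<in> carrier_mat ?n ?n" "i < ?n" "j < ?n" for A i j
    using that by simp
  \<comment> \<open>For \<open>s = 1\<close> the vector is column \<open>i\<close> of
    \<open>U\<close>, so the constraint fixes \<open>Y $$ (i, l + i)\<close>. For
    \<open>s = - 1\<close> it is a null vector of \<open>Y\<close> as soon as that entry is
    1.\<close>
  have pair: "(?e i + s \<cdot>\<^sub>v ?e (l + i)) \<bullet> (A *\<^sub>v (?e i + s \<cdot>\<^sub>v ?e (l + i))) = 1 + 2 * s * A $$ (i, l + i) + s\<^sup>2"
    if "A \<in> feasible_set l U M" "i < l" for A s i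
  proof -
    have A: "A \<in> sym_mats ?n" "A \<in> carrier_mat ?n ?n"
      using that(1) by (auto simp: feasible_set_def psd_mats_def sym_mats_def)
    then have "A $$ (i, i) = 1" "A $$ (l + i, l + i) = 1"
      using that feasible_set_iff[OF A(2), of U M] by simp_all
    then show ?thesis
      using that(2) A by (subst quadratic_form_add[OF A(1)]) (simp_all add: entry)
  qed
  have diag: "Y $$ (i, l + i) = (if i < l - 1 then 1 else 0)" if i: "i < l" for i
  proof -
    have colU: "col U i = ?e i + 1 \<cdot>\<^sub>v ?e (l + i)"
      using i by (intro eq_vecI) (auto simp: U_def)
    have "U\<^sup>T * Y * U = U\<^sup>T * Y\<^sub>0 * U"
      using Y_iff by (simp add: M_def)
    then have "col U i \<bullet> (Y *\<^sub>v col U i) = col U i \<bullet> (Y\<^sub>0 *\<^sub>v col U i)"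
      using congruence_entry[OF Uc Yc i i] congruence_entry[OF Uc psd_carrier[OF Y\<^sub>0] i i] by simp
    then have "Y $$ (i, l + i) = Y\<^sub>0 $$ (i, l + i)"
      unfolding colU pair[OF Y i] pair[OF Y\<^sub>0f i] by simp
    also have "\<dots> = (if i < l - 1 then 1 else 0)"
      using i by (auto simp: Y\<^sub>0_entry c_def)
    finally show ?thesis .
  qed
  \<comment> \<open>For \<open>i < l - 1\<close> the null vector \<open>e_i - e_(l+i)\<close> makes
    columns \<open>i\<close> and \<open>l + i\<close> of \<open>Y\<close> equal, and the last entry
    of the latter is zero by the lower identity block. For \<open>i = l - 1\<close> the entry is
    fixed by the constraint itself.\<close>
  have last: "Y $$ (?n - 1, i) = 0" if i: "i < l" for i
  proof (cases "i = l - 1")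
    case True
    then have "Y $$ (i, ?n - 1) = 0"
      using diag[OF i] i by (simp add: mult_2)
    then show ?thesis
      using sym_matsD[OF Ys, of i "?n - 1"] i by simp
  next
    case False
    then have il: "i < l - 1"
      using i by simp
    let ?v = "?e i + (- 1) \<cdot>\<^sub>v ?e (l + i)"
    have "?v \<bullet> (Y *\<^sub>v ?v) = 0"
      using pair[OF Y i, of "- 1"] diag[OF i] il by simp
    then have "Y *\<^sub>v ?v = 0\<^sub>v ?n"
      using Yp by (intro psd_null) auto
    then have "(Y *\<^sub>v ?v) $ (?n - 1) = 0"
      using assms(2) by simp
    moreover have "(Y *\<^sub>v ?v) $ (?n - 1) = Y $$ (?n - 1, i) - Y $$ (?n - 1, l + i)"
    proof -
      have "row Y (?n - 1) \<in> carrier_vec ?n"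
        using Yc by (intro carrier_vecI) simp
      then show ?thesis
        using Yc i assms(2) by (simp add: scalar_prod_add_distrib[of _ ?n])
    qed
    moreover have "Y $$ (l + (l - 1), l + i) = 0"
      using lower[of "l - 1" i] il i by simp
    ultimately show ?thesis
      using assms(2) by (simp add: mult_2)
  qed
  \<comment> \<open>The first block and the last index carry the nonzero minor of size
    \<open>l + 1\<close>.\<close>
  define J where "J = insert (?n - 1) {..<l}"
  have "Y $$ (?n - 1, ?n - 1) = 1"
  proof -
    have "Y $$ (l + (l - 1), l + (l - 1)) = 1"
      using lower[of "l - 1" "l - 1"] assms(2) by simp
    then show ?thesis
      using assms(2) by (simp add: mult_2)
  qed
  moreover have "Y $$ (i, ?n - 1) = 0" if "i < l" for i
    using last[OF that] sym_matsD[OF Ys, of i "?n - 1"] that by simp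
  ultimately have "\<forall>a\<in>J. \<forall>b\<in>J. Y $$ (a, b) = (if a = b then 1 else 0)"
    using Y_iff last assms(2) by (auto simp: J_def)
  moreover have "J \<subseteq> {..<?n}"
    using assms(2) by (auto simp: J_def)
  ultimately have "submatrix Y J J = 1\<^sub>m (card J)"
    using submatrix_eq_one_iff[OF Yc] by blast
  then have "det (submatrix Y J J) \<noteq> 0"
    by simp
  from vec_space.rank_gt_minor[OF Yc this] have "card {j. j < ?n \<and> j \<in> J} \<le> r"
    using rank by simp
  moreover have "{j. j < ?n \<and> j \<in> J} = J"
    using \<open>J \<subseteq> {..<?n}\<close> by auto
  moreover have "card J = l + 1"
    using assms(2) by (simp add: J_def card_insert_if)
  ultimately show ?thesis
    by simp
qed

section \<open>Both bounds in closed form\<close>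

theorem proposition1p7:
  fixes l :: nat
  assumes "l \<ge> 1"
  shows "l + 1 \<le> varphi l \<and>
         int (varphi l) \<le> \<lfloor>(sqrt (12 * real l * (real l + 1) + 1) - 1) / 2\<rfloor>"
proof
  show "l + 1 \<le> varphi l"
    using rank_bound_lower[OF rank_bound_varphi[OF assms] assms] .
  let ?b = "(sqrt (12 * real l * (real l + 1) + 1) - 1) / 2"
  have "rank_bound l (nat \<lfloor>?b\<rfloor>)"
  proof (rule rank_bound_upper)
    fix k
    assume "k * (k + 1) \<le> 3 * l * (l + 1)"
    then have "real (k * (k + 1)) \<le> real (3 * l * (l + 1))"
      by (simp only: of_nat_le_iff)
    \<comment> \<open>Multiplying by 4 and adding 1 completes the square:
      \<open>4 * k * (k + 1) + 1\<close> is the square of \<open>2 * k + 1\<close>.\<close>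
    then have "(2 * real k + 1)\<^sup>2 \<le> 12 * real l * (real l + 1) + 1"
      by (simp add: power2_eq_square algebra_simps)
    then have "2 * real k + 1 \<le> sqrt (12 * real l * (real l + 1) + 1)"
      by (rule real_le_rsqrt)
    then have "real k \<le> ?b"
      by simp
    then show "k \<le> nat \<lfloor>?b\<rfloor>"
      by (simp add: le_nat_iff le_floor_iff)
  qed
  then have "varphi l \<le> nat \<lfloor>?b\<rfloor>"
    by (rule varphi_le[OF assms])
  moreover have "0 \<le> \<lfloor>?b\<rfloor>"
    by simp
  ultimately show "int (varphi l) \<le> \<lfloor>?b\<rfloor>"
    by linarith
qed

end
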